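(* Let $\mathcal{C}\subseteq 2^{[n]}$ be a closed convex code. Let $\mathcal{D}$ be a downward-closed subset of $\Delta(\mathcal{C})\setminus \mathcal{C}$. Then $\mathcal{C}\cup\mathcal{D}$ is closed convex, and moreover $$\operatorname{cdim}(\mathcal{C}\cup\mathcal{D}) \le \operatorname{cdim}(\mathcal{C}) + 2.$$
   Context: Write $[n]=\{1,\ldots,n\}$. A code is a set $\mathcal{C}\subseteq 2^{[n]}$. For an ordered (indexed) collection $\mathcal{U} = \{U_1, \ldots, U_n\}$ of sets in $\mathbb{R}^d$, its code is $$\operatorname{code}(\mathcal{U}) = \{\sigma\subseteq [n] \mid \text{there exists } p\in \mathbb{R}^d \text{ such that for all } i\in[n],\ p\in U_i \text{ if and only if } i\in\sigma\},$$ and $\mathcal{U}$ is called a realization of $\operatorname{code}(\mathcal{U})$. By standing convention, all sets in realizations are bounded and $d\ge 1$ (so every realizable code contains $\emptyset$). A code is closed convex if for some $d$ it has a realization in $\mathbb{R}^d$ in which every set is closed and convex. $\operatorname{cdim}(\mathcal{C})$ is the minimum such $d$ (with the minimum over the empty set being $\infty$). $\Delta(\mathcal{C}) = \{\sigma\subseteq [n]\mid \sigma\subseteq c\text{ for some }c\in \mathcal{C}\}$ is the abstract simplicial complex generated by $\mathcal{C}$. A downward-closed set in a poset is a set of elements which contains every element of the poset that is less than some element of the set; here the poset is $\Delta(\mathcal{C})\setminus\mathcal{C}$ ordered by inclusion, i.e. if $\tau\in\mathcal{D}$ and $\rho\subseteq\tau$ with $\rho\in\Delta(\mathcal{C})\setminus\mathcal{C}$,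 then $\rho\in\mathcal{D}$. *)

theory Defs
  imports "HOL-Analysis.Analysis"
begin

text \<open>
  The dimension \<open>d\<close> has to be quantified over, so \<open>\<real>\<^sup>d\<close> is rendered as the library's
  \<^const>\<open>Euclidean_space\<close> \<open>d\<close>: the functions \<open>nat \<Rightarrow> real\<close> vanishing at all indices \<open>\<ge> d\<close>,
  with the subspace topology of the product topology. The type \<open>nat \<Rightarrow> real\<close> is not
  an instance of \<^class>\<open>real_vector\<close> and its \<^class>\<open>metric_space\<close> structure is not the
  Euclidean one, so \<open>convex\<close> and \<open>bounded\<close> are not usable; their standard
  definitions are written out here.
\<close>

definition convex_set :: "(nat \<Rightarrow> real) set \<Rightarrow> bool" where
  "convex_set S \<longleftrightarrow>
     (\<forall>x\<in>S. \<forall>y\<in>S. \<forall>u\<ge>0. \<forall>v\<ge>0. u + v = 1 \<longrightarrow> (\<lambda>i. u * x i + v * y i) \<in> S)"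

definition bounded_set :: "nat \<Rightarrow> (nat \<Rightarrow> real) set \<Rightarrow> bool" where
  "bounded_set d S \<longleftrightarrow> (\<exists>B. \<forall>x\<in>S. L2_set x {..<d} \<le> B)"

text \<open>Only the values of \<open>U\<close> on \<open>{1..n}\<close> matter: \<open>U\<close> is the indexed collection \<open>U\<^sub>1, \<dots>, U\<^sub>n\<close>.\<close>

definition code_of :: "nat \<Rightarrow> nat \<Rightarrow> (nat \<Rightarrow> (nat \<Rightarrow> real) set) \<Rightarrow> nat set set" where
  "code_of d n U =
     {\<sigma>. \<sigma> \<subseteq> {1..n} \<and>
          (\<exists>p\<in>topspace (Euclidean_space d). \<forall>i\<in>{1..n}. p \<in> U i \<longleftrightarrow> i \<in> \<sigma>)}"

text \<open>\<^const>\<open>closedin\<close> also forces each \<open>U i\<close> to be a subset of \<open>\<real>\<^sup>d\<close>.\<close>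

definition closed_convex_realization ::
    "nat \<Rightarrow> nat \<Rightarrow> (nat \<Rightarrow> (nat \<Rightarrow> real) set) \<Rightarrow> nat set set \<Rightarrow> bool" where
  "closed_convex_realization d n U \<C> \<longleftrightarrow>
     (\<forall>i\<in>{1..n}. closedin (Euclidean_space d) (U i) \<and> convex_set (U i) \<and> bounded_set d (U i)) \<and>
     code_of d n U = \<C>"

definition closed_convex_in_dim :: "nat \<Rightarrow> nat \<Rightarrow> nat set set \<Rightarrow> bool" where
  "closed_convex_in_dim d n \<C> \<longleftrightarrow> d \<ge> 1 \<and> (\<exists>U. closed_convex_realization d n U \<C>)"

definition closed_convex :: "nat \<Rightarrow> nat set set \<Rightarrow> bool" where
  "closed_convex n \<C> \<longleftrightarrow> (\<exists>d. closed_convex_in_dim d n \<C>)"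

text \<open>In \<^typ>\<open>enat\<close> the infimum of a nonempty set is its minimum, and that of the empty set is \<open>\<infinity>\<close>.\<close>

definition cdim :: "nat \<Rightarrow> nat set set \<Rightarrow> enat" where
  "cdim n \<C> = (INF d \<in> {d. closed_convex_in_dim d n \<C>}. enat d)"

definition simplicial_complex_of :: "nat \<Rightarrow> nat set set \<Rightarrow> nat set set" where
  "simplicial_complex_of n \<C> = {\<sigma>. \<sigma> \<subseteq> {1..n} \<and> (\<exists>c\<in>\<C>. \<sigma> \<subseteq> c)}"

definition downward_closed_in :: "nat set set \<Rightarrow> nat set set \<Rightarrow> bool" where
  "downward_closed_in P \<D> \<longleftrightarrow> \<D> \<subseteq> P \<and> (\<forall>\<tau>\<in>\<D>. \<forall>\<rho>\<in>P. \<rho> \<subseteq> \<tau> \<longrightarrow> \<rho> \<in> \<D>)"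

end

theory Submission
  imports Defs
begin

text \<open>
  Realize \<open>\<C>\<close> by sets \<open>U\<^sub>i\<close> in \<open>\<real>\<^sup>d\<close> and replace each \<open>U\<^sub>i\<close> by \<open>U\<^sub>i \<times> P\<^sub>i\<close>, where \<open>P\<^sub>i \<subseteq> \<real>\<^sup>2\<close> is
  obtained from a truncated parabola by cutting off disjoint open caps, one cap for each
  \<open>\<tau> \<in> \<D>\<close> with \<open>i \<notin> \<tau>\<close>. Above a point outside all caps the code is unchanged. Above a point
  of the cap of \<open>\<tau>\<close> only the indices in \<open>\<tau>\<close> survive; the codewords seen there are
  subsets of \<open>\<tau>\<close>, hence in \<open>\<C> \<union> \<D>\<close>, and \<open>\<tau>\<close> itself is one of them because
  \<open>\<tau>\<close> is contained in a codeword of \<open>\<C>\<close>.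
\<close>

section \<open>Lifting to two further dimensions\<close>

definition proj :: "nat \<Rightarrow> (nat \<Rightarrow> real) \<Rightarrow> nat \<Rightarrow> real" where
  "proj d y = (\<lambda>j. if j < d then y j else 0)"

definition extend :: "nat \<Rightarrow> (nat \<Rightarrow> real) \<Rightarrow> real \<Rightarrow> real \<Rightarrow> nat \<Rightarrow> real" where
  "extend d x s t = (\<lambda>j. if j < d then x j else if j = d then s else if j = Suc d then t else 0)"

text \<open>The cap at the point \<open>(k, k\<^sup>2)\<close> of the parabola lies below the parallel of the tangent
  there, shifted up by \<open>1/4\<close>.\<close>

definition in_cap :: "nat \<Rightarrow> real \<Rightarrow> real \<Rightarrow> bool" where
  "in_cap k s t \<longleftrightarrow> t < 2 * real k * s - (real k)\<^sup>2 + 1/4"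

text \<open>Coordinates \<open>d\<close> and \<open>Suc d\<close> carry the planar factor. The map
  \<open>f\<close> spreads the caps along the parabola, and truncation at height \<open>M\<close>
  keeps the sets bounded.\<close>

definition lifted ::
    "nat \<Rightarrow> real \<Rightarrow> (nat set \<Rightarrow> nat) \<Rightarrow> nat set set \<Rightarrow> (nat \<Rightarrow> (nat \<Rightarrow> real) set) \<Rightarrow> nat \<Rightarrow> (nat \<Rightarrow> real) set"
  where
  "lifted d M f \<D> U i =
     {y \<in> topspace (Euclidean_space (d + 2)). proj d y \<in> U i
        \<and> (y d)\<^sup>2 \<le> y (Suc d) \<and> y (Suc d) \<le> M
        \<and> (\<forall>\<tau>\<in>\<D>. i \<notin> \<tau> \<longrightarrow> \<not> in_cap (f \<tau>) (y d) (y (Suc d)))}"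

text \<open>Combining the two inequalities and completing the square gives the bound 1/4 on the
  squared distance.\<close>

lemma in_cap_dist:
  assumes "in_cap k s t" "s\<^sup>2 \<le> t"
  shows "\<bar>s - real k\<bar> < 1/2"
proof -
  have "(s - real k)\<^sup>2 < (1/2)\<^sup>2"
    using assms by (simp add: in_cap_def power2_eq_square algebra_simps)
  then show ?thesis
    using abs_le_square_iff[of "1/2" "s - real k"] by simp
qed

text \<open>Distinct naturals are at least 1 apart, so the shift 1/4, giving half-width 1/2, makes
  the caps disjoint.\<close>

lemma in_cap_unique:
  assumes "in_cap k s t" "in_cap l s t" "s\<^sup>2 \<le> t"
  shows "k = l"
  using in_cap_dist[OF assms(1,3)] in_cap_dist[OF assms(2,3)] by linarith

section \<open>Closedness, convexity and boundedness of the lifted sets\<close>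

lemma continuous_map_Euclidean_space_component:
  "continuous_map (Euclidean_space m) euclideanreal (\<lambda>y. y j)"
  unfolding Euclidean_space_def
  by (intro continuous_map_from_subtopology continuous_map_product_projection) simp

lemma continuous_map_proj:
  "continuous_map (Euclidean_space m) (Euclidean_space d) (proj d)"
proof -
  have "continuous_map (Euclidean_space m) euclideanreal (\<lambda>y. proj d y j)" for j
    by (cases "j < d") (simp_all add: proj_def continuous_map_Euclidean_space_component)
  then show ?thesis
    by (auto simp: Euclidean_space_def[of d] continuous_map_in_subtopology
        continuous_map_componentwise_UNIV proj_def)
qed

lemma closedin_continuous_map_le:
  assumes "continuous_map X euclideanreal f" "continuous_map X euclideanreal g"
  shows "closedin X {x \<in> topspace X. f x \<le> g x}"
proof -
  have "closedin X {x \<in> topspace X. g x - f x \<in> {0..}}"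
    using assms
    by (intro closedin_continuous_map_preimage[where Y = euclideanreal] continuous_map_diff) auto
  then show ?thesis by simp
qed

text \<open>As \<open>in_cap\<close> is a strict inequality, cutting off a cap means intersecting
  with a closed half-space.\<close>

lemma closedin_lifted:
  assumes "finite \<D>" "closedin (Euclidean_space d) (U i)"
  shows "closedin (Euclidean_space (d + 2)) (lifted d M f \<D> U i)"
proof -
  let ?E = "Euclidean_space (d + 2)"
  let ?C = "\<lambda>\<tau>. {y \<in> topspace ?E.
    2 * real (f \<tau>) * y d - (real (f \<tau>))\<^sup>2 + 1/4 \<le> y (Suc d)}"
  note cont = continuous_map_Euclidean_space_component
  have "closedin ?E {y \<in> topspace ?E. proj d y \<in> U i}"
    using closedin_continuous_map_preimage[OF continuous_map_proj assms(2)] .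
  moreover have "closedin ?E {y \<in> topspace ?E. (y d)\<^sup>2 \<le> y (Suc d)}"
    by (intro closedin_continuous_map_le continuous_map_real_pow cont)
  moreover have "closedin ?E {y \<in> topspace ?E. y (Suc d) \<le> M}"
    by (intro closedin_continuous_map_le cont) simp
  moreover have "closedin ?E (topspace ?E \<inter> \<Inter> (?C ` {\<tau>\<in>\<D>. i \<notin> \<tau>}))"
  proof -
    have "closedin ?E (?C \<tau>)" for \<tau>
      by (intro closedin_continuous_map_le continuous_map_add continuous_map_diff
          continuous_map_real_mult cont) simp_all
    \<comment> \<open>The whole space keeps the family nonempty when every member of
      \<open>\<D>\<close> contains \<open>i\<close>.\<close>
    then have "closedin ?E (\<Inter> (insert (topspace ?E) (?C ` {\<tau>\<in>\<D>. i \<notin> \<tau>})))"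
      by (intro closedin_Inter) auto
    then show ?thesis by simp
  qed
  moreover have "lifted d M f \<D> U i =
      {y \<in> topspace ?E. proj d y \<in> U i} \<inter> {y \<in> topspace ?E. (y d)\<^sup>2 \<le> y (Suc d)}
      \<inter> {y \<in> topspace ?E. y (Suc d) \<le> M}
      \<inter> (topspace ?E \<inter> \<Inter> (?C ` {\<tau>\<in>\<D>. i \<notin> \<tau>}))"
    by (auto simp: lifted_def in_cap_def not_less)
  ultimately show ?thesis
    by (simp only: closedin_Int)
qed

text \<open>Each constraint is convex: a preimage of \<open>U i\<close> under a linear map, the
  epigraph of the square, and half-spaces.\<close>

lemma convex_set_lifted:
  assumes "convex_set (U i)"
  shows "convex_set (lifted d M f \<D> U i)"
  unfolding convex_set_def
proof (intro ballI allI impI)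
  fix x y u v
  assume x: "x \<in> lifted d M f \<D> U i" and y: "y \<in> lifted d M f \<D> U i"
    and uv: "0 \<le> u" "0 \<le> v" "u + v = (1::real)"
  let ?z = "\<lambda>j. u * x j + v * y j"
  have top: "?z \<in> topspace (Euclidean_space (d + 2))"
    using x y by (auto simp: lifted_def topspace_Euclidean_space)
  have "proj d ?z = (\<lambda>j. u * proj d x j + v * proj d y j)"
    by (auto simp: proj_def)
  then have pr: "proj d ?z \<in> U i"
    using assms x y uv by (auto simp: lifted_def convex_set_def)
  have "(?z d)\<^sup>2 \<le> u * (x d)\<^sup>2 + v * (y d)\<^sup>2"
  proof -
    have v: "v = 1 - u" using uv by simp
    \<comment> \<open>The exact gap in the convexity inequality for the square.\<close>
    have "u * (x d)\<^sup>2 + v * (y d)\<^sup>2 - (?z d)\<^sup>2 = u * v * (x d - y d)\<^sup>2"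
      unfolding v by (simp add: power2_eq_square algebra_simps)
    then show ?thesis
      using uv by (smt (verit) mult_nonneg_nonneg zero_le_power2)
  qed
  also have "\<dots> \<le> u * x (Suc d) + v * y (Suc d)"
    using x y uv by (intro add_mono mult_left_mono) (auto simp: lifted_def)
  finally have par: "(?z d)\<^sup>2 \<le> ?z (Suc d)" .
  have M: "?z (Suc d) \<le> M"
    using x y uv by (intro convex_bound_le) (auto simp: lifted_def)
  have "\<not> in_cap (f \<tau>) (?z d) (?z (Suc d))" if "\<tau> \<in> \<D>" "i \<notin> \<tau>" for \<tau>
  proof -
    let ?l = "\<lambda>w. 2 * real (f \<tau>) * w d - w (Suc d)"
    let ?c = "(real (f \<tau>))\<^sup>2 - 1/4"
    have "?l x \<le> ?c" "?l y \<le> ?c"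
      using x y that by (force simp: lifted_def in_cap_def not_less)+
    then have "u * ?l x + v * ?l y \<le> ?c"
      using uv by (intro convex_bound_le) auto
    then show ?thesis
      by (simp add: in_cap_def algebra_simps)
  qed
  with top pr par M show "?z \<in> lifted d M f \<D> U i"
    by (auto simp: lifted_def)
qed

lemma bounded_set_lifted:
  assumes "bounded_set d (U i)"
  shows "bounded_set (d + 2) (lifted d M f \<D> U i)"
proof -
  obtain B where B: "\<And>x. x \<in> U i \<Longrightarrow> L2_set x {..<d} \<le> B"
    using assms by (auto simp: bounded_set_def)
  have "L2_set y {..<d + 2} \<le> sqrt (B\<^sup>2 + M + M\<^sup>2)" if y: "y \<in> lifted d M f \<D> U i" for y
  proof -
    have "L2_set y {..<d} = L2_set (proj d y) {..<d}"
      by (intro L2_set_cong) (auto simp: proj_def)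
    also have "\<dots> \<le> B"
      using y B by (auto simp: lifted_def)
    finally have "(L2_set y {..<d})\<^sup>2 \<le> B\<^sup>2"
      by (intro power_mono) auto
    then have "(\<Sum>j<d. (y j)\<^sup>2) \<le> B\<^sup>2"
      by (simp add: L2_set_def sum_nonneg)
    moreover have le: "(y d)\<^sup>2 \<le> y (Suc d)" "y (Suc d) \<le> M"
      using y by (auto simp: lifted_def)
    \<comment> \<open>The parabola supplies the lower bound 0 that squaring requires.\<close>
    moreover have "(y (Suc d))\<^sup>2 \<le> M\<^sup>2"
      using le order_trans[OF zero_le_power2 le(1)] by (intro power_mono) auto
    ultimately show ?thesis
      by (simp add: L2_set_def)
  qed
  then show ?thesis
    by (auto simp: bounded_set_def)
qed

section \<open>The code of the lifted sets\<close>

text \<open>A point far out on the first axis escapes all the bounded sets.\<close>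

lemma empty_in_code_of:
  assumes "d \<ge> 1" and "\<And>i. i \<in> {1..n} \<Longrightarrow> bounded_set d (U i)"
  shows "{} \<in> code_of d n U"
proof -
  obtain B where B: "\<And>i x. i \<in> {1..n} \<Longrightarrow> x \<in> U i \<Longrightarrow> L2_set x {..<d} \<le> B i"
    using assms(2) unfolding bounded_set_def by metis
  \<comment> \<open>Absolute values let \<open>R\<close> dominate each \<open>B i\<close> even if
    some are negative; the summand 1 makes this strict.\<close>
  define R where "R = (\<Sum>i\<in>{1..n}. \<bar>B i\<bar>) + 1"
  let ?p = "\<lambda>j::nat. if j = 0 then R else 0"
  have "?p \<notin> U i" if i: "i \<in> {1..n}" for i
  proof
    assume "?p \<in> U i"
    then have "L2_set ?p {..<d} \<le> B i"
      using B i by blast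
    moreover have "R \<le> L2_set ?p {..<d}"
      using member_le_L2_set[of "{..<d}" 0 ?p] assms(1) by simp
    moreover have "\<bar>B i\<bar> \<le> (\<Sum>i\<in>{1..n}. \<bar>B i\<bar>)"
      using i by (intro member_le_sum) auto
    ultimately show False
      unfolding R_def by linarith
  qed
  moreover have "?p \<in> topspace (Euclidean_space d)"
    using assms(1) by (auto simp: topspace_Euclidean_space)
  ultimately show ?thesis
    unfolding code_of_def by blast
qed

text \<open>The bounds on \<open>M\<close> keep the planar witnesses in the truncated parabola: (-1,
  M) for words of \<open>\<C>\<close>, the cap's point on the parabola for words of
  \<open>\<D>\<close>.\<close>

lemma closed_convex_realization_lifted:
  assumes U: "closed_convex_realization d n U \<C>" and d: "d \<ge> 1"
    and \<D>: "downward_closed_in (simplicial_complex_of n \<C> - \<C>) \<D>"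
    and f: "inj_on f \<D>" and M: "1 \<le> M" "\<And>\<tau>. \<tau> \<in> \<D> \<Longrightarrow> (real (f \<tau>))\<^sup>2 \<le> M"
  shows "closed_convex_realization (d + 2) n (lifted d M f \<D> U) (\<C> \<union> \<D>)"
proof -
  let ?E = "Euclidean_space (d + 2)" and ?L = "lifted d M f \<D> U"
  have D: "\<tau> \<subseteq> {1..n}" "\<exists>c\<in>\<C>. \<tau> \<subseteq> c" if "\<tau> \<in> \<D>" for \<tau>
    using \<D> that by (auto simp: downward_closed_in_def simplicial_complex_of_def)
  \<comment> \<open>Downward closure enters here: a face of \<tau> missing from \<open>\<C>\<close>
    must lie in \<open>\<D>\<close>.\<close>
  have sub: "\<sigma> \<in> \<C> \<union> \<D>" if "\<tau> \<in> \<D>" "\<sigma> \<subseteq> \<tau>" for \<sigma> \<tau>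
  proof -
    have "\<sigma> \<in> simplicial_complex_of n \<C>"
      using D[OF that(1)] that(2) by (auto simp: simplicial_complex_of_def)
    then show ?thesis
      using \<D> that by (auto simp: downward_closed_in_def)
  qed
  have "\<D> \<subseteq> Pow {1..n}"
    using D(1) by blast
  then have fin: "finite \<D>"
    by (rule finite_subset) simp
  have code: "code_of d n U = \<C>"
    and props: "\<And>i. i \<in> {1..n} \<Longrightarrow>
      closedin (Euclidean_space d) (U i) \<and> convex_set (U i) \<and> bounded_set d (U i)"
    using U by (auto simp: closed_convex_realization_def)
  \<comment> \<open>Points outside the truncated parabola lie in no lifted set and so yield this
    word.\<close>
  have empty: "{} \<in> \<C>"
    using empty_in_code_of[of d n U] d props code by blast
  have extend_simps: "proj d (extend d p s t) = p" "extend d p s t d = s"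
      "extend d p s t (Suc d) = t" "extend d p s t \<in> topspace (Euclidean_space (Suc (Suc d)))"
    if "p \<in> topspace (Euclidean_space d)" for p s t
    using that by (auto simp: proj_def extend_def topspace_Euclidean_space)
  have proj_top: "proj d y \<in> topspace (Euclidean_space d)" for y
    by (auto simp: proj_def topspace_Euclidean_space)
  have "\<sigma> \<in> \<C> \<union> \<D>" if \<sigma>: "\<sigma> \<in> code_of (d + 2) n ?L" for \<sigma>
  proof -
    obtain y where y: "y \<in> topspace ?E" "\<sigma> \<subseteq> {1..n}" "\<forall>i\<in>{1..n}. y \<in> ?L i \<longleftrightarrow> i \<in> \<sigma>"
      using \<sigma> by (auto simp: code_of_def)
    show ?thesis
    proof (cases "(y d)\<^sup>2 \<le> y (Suc d) \<and> y (Suc d) \<le> M")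
      case False
      then have "\<sigma> = {}"
        using y by (auto simp: lifted_def)
      then show ?thesis
        using empty by simp
    next
      case K: True
      show ?thesis
      proof (cases "\<exists>\<tau>\<in>\<D>. in_cap (f \<tau>) (y d) (y (Suc d))")
        case True
        then obtain \<tau> where \<tau>: "\<tau> \<in> \<D>" "in_cap (f \<tau>) (y d) (y (Suc d))"
          by blast
        then have "\<sigma> \<subseteq> \<tau>"
          using y by (auto simp: lifted_def)
        then show ?thesis
          using sub \<tau>(1) by blast
      next
        case False
        then have "\<forall>i\<in>{1..n}. proj d y \<in> U i \<longleftrightarrow> i \<in> \<sigma>"
          using y K by (auto simp: lifted_def)
        then have "\<sigma> \<in> code_of d n U"
          using y(2) proj_top by (auto simp: code_of_def)
        then show ?thesis
          using code by simp
      qed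
    qed
  qed
  moreover have "\<sigma> \<in> code_of (d + 2) n ?L" if "\<sigma> \<in> \<C>" for \<sigma>
  proof -
    have "\<sigma> \<in> code_of d n U"
      using that code by simp
    then obtain p where p: "p \<in> topspace (Euclidean_space d)" "\<sigma> \<subseteq> {1..n}"
        "\<forall>i\<in>{1..n}. p \<in> U i \<longleftrightarrow> i \<in> \<sigma>"
      by (auto simp: code_of_def)
    \<comment> \<open>The abscissa -1 is at distance at least 1 from every natural, hence in no
      cap.\<close>
    have "\<not> in_cap k (-1) M" for k
      using in_cap_dist[of k "-1" M] M(1) by auto
    then have "\<forall>i\<in>{1..n}. extend d p (-1) M \<in> ?L i \<longleftrightarrow> i \<in> \<sigma>"
      using p M(1) by (auto simp: lifted_def extend_simps)
    then show ?thesis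
      using p extend_simps(4) by (auto simp: code_of_def)
  qed
  moreover have "\<tau> \<in> code_of (d + 2) n ?L" if \<tau>: "\<tau> \<in> \<D>" for \<tau>
  proof -
    obtain c where c: "c \<in> \<C>" "\<tau> \<subseteq> c"
      using D(2)[OF \<tau>] by blast
    then obtain p where p: "p \<in> topspace (Euclidean_space d)"
        "\<forall>i\<in>{1..n}. p \<in> U i \<longleftrightarrow> i \<in> c"
      using code by (auto simp: code_of_def)
    let ?k = "real (f \<tau>)"
    have cap: "in_cap (f \<tau>) ?k (?k\<^sup>2)"
      by (simp add: in_cap_def power2_eq_square)
    \<comment> \<open>Only the cap of \<tau> contains this point, so no index in \<tau> is
      lost.\<close>
    have other: "\<tau>' = \<tau>" if "\<tau>' \<in> \<D>" "in_cap (f \<tau>') ?k (?k\<^sup>2)" for \<tau>'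
      using in_cap_unique[OF that(2) cap] inj_onD[OF f] that(1) \<tau> by simp
    have "\<forall>i\<in>{1..n}. extend d p ?k (?k\<^sup>2) \<in> ?L i \<longleftrightarrow> i \<in> \<tau>"
      using p c(2) \<tau> M(2)[OF \<tau>] cap other by (auto simp: lifted_def extend_simps)
    then show ?thesis
      using D(1)[OF \<tau>] extend_simps(4)[OF p(1)] by (auto simp: code_of_def)
  qed
  ultimately have "code_of (d + 2) n ?L = \<C> \<union> \<D>"
    by (intro equalityI subsetI) auto
  then show ?thesis
    using props fin
    by (simp add: closed_convex_realization_def closedin_lifted convex_set_lifted
        bounded_set_lifted del: add_2_eq_Suc')
qed

lemma closed_convex_in_dim_Un:
  assumes "closed_convex_in_dim d n \<C>"
    and \<D>: "downward_closed_in (simplicial_complex_of n \<C> - \<C>) \<D>"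
  shows "closed_convex_in_dim (d + 2) n (\<C> \<union> \<D>)"
proof -
  obtain U where d: "d \<ge> 1" and U: "closed_convex_realization d n U \<C>"
    using assms(1) by (auto simp: closed_convex_in_dim_def)
  have "\<D> \<subseteq> Pow {1..n}"
    using \<D> by (auto simp: downward_closed_in_def simplicial_complex_of_def)
  then have fin: "finite \<D>"
    by (rule finite_subset) simp
  then obtain f :: "nat set \<Rightarrow> nat" where f: "inj_on f \<D>"
    using finite_imp_inj_to_nat_seg by blast
  \<comment> \<open>The sum dominates every square; the 1 makes room for the abscissa -1.\<close>
  let ?M = "1 + (\<Sum>\<tau>\<in>\<D>. (real (f \<tau>))\<^sup>2)"
  have "1 \<le> ?M"
    by (simp add: sum_nonneg)
  moreover have "(real (f \<tau>))\<^sup>2 \<le> ?M" if "\<tau> \<in> \<D>" for \<tau>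
    using member_le_sum[of \<tau> \<D> "\<lambda>\<tau>. (real (f \<tau>))\<^sup>2"] that fin by simp
  ultimately have "closed_convex_realization (d + 2) n (lifted d ?M f \<D> U) (\<C> \<union> \<D>)"
    using closed_convex_realization_lifted[OF U d \<D> f] by blast
  then show ?thesis
    unfolding closed_convex_in_dim_def by auto
qed

theorem theorem17:
  fixes n :: nat and \<C> \<D> :: "nat set set"
  assumes "\<C> \<subseteq> Pow {1..n}"
    and "closed_convex n \<C>"
    and "downward_closed_in (simplicial_complex_of n \<C> - \<C>) \<D>"
  shows "closed_convex n (\<C> \<union> \<D>) \<and> cdim n (\<C> \<union> \<D>) \<le> cdim n \<C> + 2"
proof -
  obtain e where "closed_convex_in_dim e n \<C>"
    using assms(2) by (auto simp: closed_convex_def)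
  \<comment> \<open>The infimum is attained, so it suffices to lift a realization of minimal
    dimension.\<close>
  then have "cdim n \<C> \<in> enat ` {d. closed_convex_in_dim d n \<C>}"
    by (auto simp: cdim_def Inf_enat_def intro: LeastI)
  then obtain d where d: "closed_convex_in_dim d n \<C>" "cdim n \<C> = enat d"
    by blast
  have d2: "closed_convex_in_dim (d + 2) n (\<C> \<union> \<D>)"
    using closed_convex_in_dim_Un[OF d(1) assms(3)] .
  then have "cdim n (\<C> \<union> \<D>) \<le> enat (d + 2)"
    unfolding cdim_def by (intro INF_lower) simp
  also have "\<dots> = cdim n \<C> + 2"
    using d(2) by (simp add: numeral_eq_enat)
  finally show ?thesis
    using d2 by (auto simp: closed_convex_def)
qed

end
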